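(* Let $m\ge 1$, let $p_1,\dots,p_m$ be p-values (random variables with values in $[0,1]$ on a common probability space, with arbitrary joint distribution), let $\alpha\in[0,1]$, and let $\tilde{\pi}_0(\lambda)$, with tuning parameter $\lambda\in[0,1)$, be an estimator of the proportion of true nulls taking values in $[0,1]$. Let $\widetilde{FDR}_\lambda$ be the associated Storey-type FDR estimator, let $\tilde t_\alpha(\lambda)=\sup\{t\in[0,1]:\widetilde{FDR}_\lambda(t)\le\alpha\}$ be the rejection threshold, and let $\mathcal{G}=\{\mathcal{F}_{t\wedge\lambda}:1\ge t\ge 0\}$ be the stopped backward filtration. If $\tilde{\pi}_0(\lambda)$ is regular, then $\tilde t_\alpha(\lambda)$ is a stopping time with respect to $\mathcal{G}$. Further, if $\tilde t_\alpha(\lambda)<1$, then $$\widetilde{FDR}_\lambda\bigl(\tilde t_\alpha(\lambda)\bigr)=\alpha .$$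
   Context: There are $m$ null hypotheses $H_1,\dots,H_m$ with associated p-values $p_1,\dots,p_m$ on a probability space $(\Omega,\mathcal{A},\mathbb{P})$; $m_0$ of the hypotheses are true nulls and $\pi_0=m_0/m$. No assumption is made on the dependence among the p-values or on their distributions. For $t\in[0,1]$, $R(t)=\sum_{i=1}^m\mathbf{1}_{\{p_i\le t\}}$ is the number of hypotheses claimed to be false nulls when the rejection threshold is $t$. Storey-type FDR estimator: $$\widetilde{FDR}_\lambda(t)=\min\left\{1,\frac{\tilde{\pi}_0(\lambda)\,t}{m^{-1}\max\{R(t),1\}}\right\},\qquad t\in[0,1].$$ The corresponding Storey-type FDR procedure claims $H_i$ to be a false null if and only if $p_i\le \tilde t_\alpha(\lambda)$. Backward filtration: $\mathcal{F}_t=\sigma\bigl(\mathbf{1}_{\{p_i\le s\}}: t\le s\le 1,\ i=1,\dots,m\bigr)$ for $t\in[0,1)$, which is non-increasing in $t$. Regular: the estimator $\tilde{\pi}_0(\lambda)$ is called regular if it is measurable with respect to $\mathcal{F}_\lambda$. Stopping time with respect to $\mathcal{G}$ (time runs backward from $1$ to $0$): $\{\omega\in\Omega:\tilde t_\alpha(\lambda)(\omega)\le s\}\in\mathcal{F}_{s\wedge\lambda}$ for every $s\in[0,1]$. The equality $\widetilde{FDR}_\lambda(\tilde t_\alpha(\lambda))=\alpha$ is understood pointwise, at each $\omega\in\Omega$ for which $\tilde t_\alpha(\lambda)(\omega)<1$. *)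

theory Defs
  imports "HOL-Probability.Probability"
begin

definition generated_sigma :: "'a set \<Rightarrow> 'i set \<Rightarrow> ('i \<Rightarrow> 'a \<Rightarrow> real) \<Rightarrow> 'a measure" where
  "generated_sigma \<Omega> I X = sigma \<Omega> {X i -` B \<inter> \<Omega> | i B. i \<in> I \<and> B \<in> sets borel}"

definition num_rejections :: "nat \<Rightarrow> (nat \<Rightarrow> 'a \<Rightarrow> real) \<Rightarrow> real \<Rightarrow> 'a \<Rightarrow> nat" where
  "num_rejections m p t \<omega> = (\<Sum>i=1..m. of_bool (p i \<omega> \<le> t))"

text \<open>
  In the next two definitions \<open>q\<close> is the estimator of the proportion of true nulls for one
  fixed value of its tuning parameter.
\<close>

definition storey_FDR ::
    "nat \<Rightarrow> (nat \<Rightarrow> 'a \<Rightarrow> real) \<Rightarrow> ('a \<Rightarrow> real) \<Rightarrow> real \<Rightarrow> 'a \<Rightarrow> real" where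
  "storey_FDR m p q t \<omega> =
     min 1 (q \<omega> * t / (inverse (real m) * real (max (num_rejections m p t \<omega>) 1)))"

definition storey_threshold ::
    "nat \<Rightarrow> (nat \<Rightarrow> 'a \<Rightarrow> real) \<Rightarrow> ('a \<Rightarrow> real) \<Rightarrow> real \<Rightarrow> 'a \<Rightarrow> real" where
  "storey_threshold m p q \<alpha> \<omega> = Sup {t \<in> {0..1}. storey_FDR m p q t \<omega> \<le> \<alpha>}"

definition backward_filtration ::
    "'a measure \<Rightarrow> nat \<Rightarrow> (nat \<Rightarrow> 'a \<Rightarrow> real) \<Rightarrow> real \<Rightarrow> 'a measure" where
  "backward_filtration M m p t =
     generated_sigma (space M) ({1..m} \<times> {t..1}) (\<lambda>(i, s) \<omega>. of_bool (p i \<omega> \<le> s))"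

definition stopped_backward_filtration ::
    "'a measure \<Rightarrow> nat \<Rightarrow> (nat \<Rightarrow> 'a \<Rightarrow> real) \<Rightarrow> real \<Rightarrow> real \<Rightarrow> 'a measure" where
  "stopped_backward_filtration M m p lam t = backward_filtration M m p (min t lam)"

definition regular_estimator ::
    "'a measure \<Rightarrow> nat \<Rightarrow> (nat \<Rightarrow> 'a \<Rightarrow> real) \<Rightarrow> real \<Rightarrow> ('a \<Rightarrow> real) \<Rightarrow> bool" where
  "regular_estimator M m p lam q \<longleftrightarrow> q \<in> borel_measurable (backward_filtration M m p lam)"

text \<open>
  Time is the interval \<open>[0,1]\<close> run backward, along a family \<open>G\<close> that is non-increasing in its
  index. The library's \<open>stopping_time\<close> has the same event \<open>{T \<le> s}\<close>, but there the whole
  index type is the time set.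
\<close>

definition backward_stopping_time :: "(real \<Rightarrow> 'a measure) \<Rightarrow> ('a \<Rightarrow> real) \<Rightarrow> bool" where
  "backward_stopping_time G T \<longleftrightarrow>
     (\<forall>s\<in>{0..1}. {\<omega> \<in> space (G s). T \<omega> \<le> s} \<in> sets (G s))"

end

theory Submission imports Defs begin

text \<open>
  For a fixed outcome let \<open>R\<close> count the p-values below a threshold. It is a non-decreasing,
  right-continuous step function that jumps only at the p-values. Between jumps the estimated FDR
  is proportional to the threshold (capped at 1), and at a jump it can only drop. Both claims rest
  on this shape.

  Stopping time: the threshold exceeds \<open>s\<close> iff the estimated FDR is at most \<open>\<alpha>\<close> at some \<open>t > s\<close>
  (\<open>storey_threshold_le_iff\<close>). An uncountable union over \<open>t\<close> need not be measurable, and rational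
  \<open>t\<close> alone do not suffice: the estimate may touch level \<open>\<alpha>\<close> only at a jump. But sliding \<open>t\<close> down
  without changing \<open>R\<close> lowers the estimate, so \<open>t\<close> can be taken to be a p-value above \<open>s\<close>, or,
  when no p-value lies in \<open>(s, t]\<close>, a rational number (\<open>ex_storey_FDR_le_iff\<close>). What remains is
  that the estimate at a random location \<open>\<tau> \<ge> s\<close> depends on the p-values only through
  \<open>max (p i) s\<close>, which the backward filtration observes (\<open>measurable_storey_FDR\<close>).

  Level attained: downward jumps make the estimate lower semicontinuous, so the
  supremum inherits the bound \<open>\<alpha>\<close> (\<open>storey_FDR_threshold_le\<close>). Right-continuity carries the strict
  inequality, valid at every point above the threshold, to the reverse bound at the threshold
  itself (\<open>storey_FDR_threshold_ge\<close>).
\<close>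

section \<open>The estimated FDR along a single outcome\<close>

lemma num_rejections_mono:
  "s \<le> t \<Longrightarrow> num_rejections m p s \<omega> \<le> num_rejections m p t \<omega>"
  unfolding num_rejections_def by (intro sum_mono) auto

lemma num_rejections_eqI:
  assumes "s \<le> t" and "\<And>i. i \<in> {1..m} \<Longrightarrow> p i \<omega> \<notin> {s<..t}"
  shows "num_rejections m p t \<omega> = num_rejections m p s \<omega>"
  unfolding num_rejections_def
proof (rule sum.cong)
  fix i assume "i \<in> {1..m}"
  with assms show "of_bool (p i \<omega> \<le> t) = (of_bool (p i \<omega> \<le> s) :: nat)"
    by (smt (verit) greaterThanAtMost_iff)
qed simp

lemma eventually_num_rejections_eq_at_right:
  "eventually (\<lambda>u. num_rejections m p u \<omega> = num_rejections m p t \<omega>) (at_right t)"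
proof -
  have "eventually (\<lambda>u. p i \<omega> \<notin> {t<..u}) (at_right t)" for i
  proof (cases "t < p i \<omega>")
    case True
    then show ?thesis
      using eventually_at_right_less eventually_at_right[OF True]
      by (auto intro!: exI[of _ "p i \<omega>"])
  qed simp
  then have "eventually (\<lambda>u. \<forall>i\<in>{1..m}. p i \<omega> \<notin> {t<..u}) (at_right t)"
    by (intro eventually_ball_finite) auto
  moreover have "eventually (\<lambda>u. t < u) (at_right t)"
    by (rule eventually_at_right_less)
  ultimately show ?thesis
    by eventually_elim (intro num_rejections_eqI; force)
qed

text \<open>
  The two competing monotonicities: the estimate grows with the threshold and shrinks with the
  number of rejections. Allowing any two locations with comparable counts covers sliding down a
  constancy interval.
\<close>

lemma storey_FDR_le:
  assumes "0 \<le> q \<omega>" "0 \<le> s" "s \<le> t"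
    and "num_rejections m p t \<omega> \<le> num_rejections m p s \<omega>"
  shows "storey_FDR m p q s \<omega> \<le> storey_FDR m p q t \<omega>"
  \<comment> \<open>For \<open>m = 0\<close> the denominator is 0, and both estimates are 0 by the convention \<open>x / 0 = 0\<close>.\<close>
proof (cases "m = 0")
  case False
  then show ?thesis
    using assms unfolding storey_FDR_def
    by (intro min.mono order_refl frac_le mult_left_mono mult_nonneg_nonneg mult_pos_pos) auto
qed (simp add: storey_FDR_def)

text \<open>
  Any admissible \<open>t > s\<close> can be traded for the largest p-value in \<open>(s, t]\<close>, or for
  a rational number if that interval is free of p-values: the count \<open>R\<close> is unchanged. This
  reduces the event to a countable union.
\<close>

lemma ex_storey_FDR_le_iff:
  assumes "0 \<le> q \<omega>" "0 \<le> s"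
  shows "(\<exists>t\<in>{s<..1}. storey_FDR m p q t \<omega> \<le> \<alpha>) \<longleftrightarrow>
     (\<exists>t\<in>\<rat> \<inter> {s<..1}. storey_FDR m p q t \<omega> \<le> \<alpha>) \<or>
     (\<exists>i\<in>{1..m}. p i \<omega> \<in> {s<..1} \<and> storey_FDR m p q (p i \<omega>) \<omega> \<le> \<alpha>)"
    (is "?L \<longleftrightarrow> ?R")
proof
  assume ?R
  then show ?L
    by blast
next
  assume ?L
  then obtain t where t: "s < t" "t \<le> 1" and le: "storey_FDR m p q t \<omega> \<le> \<alpha>"
    by auto
  define A where "A = {i \<in> {1..m}. p i \<omega> \<in> {s<..t}}"
  have "finite A"
    by (simp add: A_def)
  show ?R
  proof (cases "A = {}")
    case True
    obtain u where u: "u \<in> \<rat>" "s < u" "u < t"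
      using Rats_dense_in_real[OF t(1)] by auto
    have "num_rejections m p t \<omega> = num_rejections m p u \<omega>"
      using True u by (intro num_rejections_eqI) (force simp: A_def)+
    then have "storey_FDR m p q u \<omega> \<le> storey_FDR m p q t \<omega>"
      using assms u by (intro storey_FDR_le) auto
    with u t le show ?thesis
      by (intro disjI1 bexI[of _ u]) auto
  next
    case False
    have "Max ((\<lambda>i. p i \<omega>) ` A) \<in> (\<lambda>i. p i \<omega>) ` A"
      using \<open>finite A\<close> False by (intro Max_in) auto
    then obtain i where i: "i \<in> A" and i_max: "p i \<omega> = Max ((\<lambda>i. p i \<omega>) ` A)"
      by auto
    have largest: "p j \<omega> \<le> p i \<omega>" if "j \<in> A" for j
      unfolding i_max using \<open>finite A\<close> that by (intro Max_ge) auto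
    have between: "s < p i \<omega>" "p i \<omega> \<le> t" "i \<in> {1..m}"
      using i by (auto simp: A_def)
    have "num_rejections m p t \<omega> = num_rejections m p (p i \<omega>) \<omega>"
      using between largest by (intro num_rejections_eqI) (force simp: A_def)+
    then have "storey_FDR m p q (p i \<omega>) \<omega> \<le> storey_FDR m p q t \<omega>"
      using assms between by (intro storey_FDR_le) auto
    with between t le show ?thesis
      by (intro disjI2 bexI[of _ i]) auto
  qed
qed

section \<open>The threshold attains its level\<close>

text \<open>The estimate vanishes at 0, so for \<open>\<alpha> \<ge> 0\<close> the supremum is never taken
  over an empty set.\<close>

lemma storey_FDR_0: "storey_FDR m p q 0 \<omega> = 0"
  by (simp add: storey_FDR_def)

lemma storey_set_nonempty:
  assumes "0 \<le> \<alpha>"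
  shows "{t \<in> {0..1}. storey_FDR m p q t \<omega> \<le> \<alpha>} \<noteq> {}"
  using assms by (auto intro!: exI[of _ 0] simp: storey_FDR_0)

lemma bdd_above_storey_set: "bdd_above {t \<in> {0..1::real}. storey_FDR m p q t \<omega> \<le> \<alpha>}"
  by (rule bdd_aboveI[of _ 1]) auto

lemma le_storey_threshold:
  "t \<in> {0..1} \<Longrightarrow> storey_FDR m p q t \<omega> \<le> \<alpha> \<Longrightarrow> t \<le> storey_threshold m p q \<alpha> \<omega>"
  unfolding storey_threshold_def by (intro cSup_upper bdd_above_storey_set) auto

lemma storey_threshold_nonneg: "0 \<le> \<alpha> \<Longrightarrow> 0 \<le> storey_threshold m p q \<alpha> \<omega>"
  by (intro le_storey_threshold) (simp_all add: storey_FDR_0)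

lemma storey_threshold_le_iff:
  assumes "0 \<le> \<alpha>" "0 \<le> s"
  shows "storey_threshold m p q \<alpha> \<omega> \<le> s \<longleftrightarrow> \<not> (\<exists>t\<in>{s<..1}. storey_FDR m p q t \<omega> \<le> \<alpha>)"
proof -
  have "s < storey_threshold m p q \<alpha> \<omega> \<longleftrightarrow>
      (\<exists>t\<in>{t \<in> {0..1}. storey_FDR m p q t \<omega> \<le> \<alpha>}. s < t)"
    unfolding storey_threshold_def
    by (intro less_cSup_iff storey_set_nonempty bdd_above_storey_set assms)
  also have "\<dots> \<longleftrightarrow> (\<exists>t\<in>{s<..1}. storey_FDR m p q t \<omega> \<le> \<alpha>)"
    unfolding Bex_def using assms(2) by (intro ex_cong1) auto
  finally show ?thesis
    by (simp only: not_less[symmetric])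
qed

text \<open>
  With the count held at its value at the threshold, the estimate becomes a continuous function
  of \<open>t\<close> that bounds the true estimate from below on the left of the threshold. Its sublevel set
  is closed, hence contains the supremum.
\<close>

lemma storey_FDR_threshold_le:
  assumes "0 \<le> q \<omega>" "0 \<le> \<alpha>"
  shows "storey_FDR m p q (storey_threshold m p q \<alpha> \<omega>) \<omega> \<le> \<alpha>"
proof -
  define T where "T = storey_threshold m p q \<alpha> \<omega>"
  define g where
    "g t = min 1 (q \<omega> * t / (inverse (real m) * real (max (num_rejections m p T \<omega>) 1)))" for t
  let ?S = "{t \<in> {0..1}. storey_FDR m p q t \<omega> \<le> \<alpha>}"
  have below: "g t \<le> storey_FDR m p q t \<omega>" if "0 \<le> t" "t \<le> T" for t
  proof (cases "m = 0")
    case False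
    then show ?thesis
      using assms that num_rejections_mono[OF that(2), of m p \<omega>]
      unfolding g_def storey_FDR_def
      by (intro min.mono order_refl frac_le mult_left_mono mult_nonneg_nonneg mult_pos_pos) auto
  qed (simp add: g_def storey_FDR_def)
  have "?S \<subseteq> {t. g t \<le> \<alpha>}"
    using below le_storey_threshold unfolding T_def by force
  moreover have "closed {t. g t \<le> \<alpha>}"
    unfolding g_def divide_inverse
    by (intro closed_Collect_le continuous_intros)
  ultimately have "closure ?S \<subseteq> {t. g t \<le> \<alpha>}"
    by (rule closure_minimal)
  moreover have "Sup ?S \<in> closure ?S"
    by (intro closure_contains_Sup storey_set_nonempty bdd_above_storey_set assms)
  ultimately have "g T \<le> \<alpha>"
    unfolding T_def storey_threshold_def by blast
  then show ?thesis
    by (simp add: g_def storey_FDR_def T_def)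
qed

lemma storey_FDR_tendsto_at_right:
  "((\<lambda>u. storey_FDR m p q u \<omega>) \<longlongrightarrow> storey_FDR m p q t \<omega>) (at_right t)"
proof -
  let ?g = "\<lambda>u. min 1 (q \<omega> * u / (inverse (real m) * real (max (num_rejections m p t \<omega>) 1)))"
  have "(?g \<longlongrightarrow> ?g t) (at_right t)"
    unfolding divide_inverse by (intro tendsto_intros)
  moreover have "eventually (\<lambda>u. ?g u = storey_FDR m p q u \<omega>) (at_right t)"
    using eventually_num_rejections_eq_at_right[of m p \<omega> t]
    by eventually_elim (simp add: storey_FDR_def)
  ultimately have "((\<lambda>u. storey_FDR m p q u \<omega>) \<longlongrightarrow> ?g t) (at_right t)"
    by (rule Lim_transform_eventually)
  then show ?thesis
    by (simp add: storey_FDR_def)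
qed

lemma storey_FDR_threshold_ge:
  assumes "0 \<le> \<alpha>" and "storey_threshold m p q \<alpha> \<omega> < 1"
  shows "\<alpha> \<le> storey_FDR m p q (storey_threshold m p q \<alpha> \<omega>) \<omega>"
proof (rule tendsto_lowerbound[OF storey_FDR_tendsto_at_right])
  let ?T = "storey_threshold m p q \<alpha> \<omega>"
  have "eventually (\<lambda>u. u \<in> {?T<..<1}) (at_right ?T)"
    using assms(2) by (rule eventually_at_right_real)
  then show "eventually (\<lambda>u. \<alpha> \<le> storey_FDR m p q u \<omega>) (at_right ?T)"
  proof eventually_elim
    case (elim u)
    then show ?case
      using le_storey_threshold[of u m p q \<omega> \<alpha>] storey_threshold_nonneg[OF assms(1), of m p q \<omega>]
      by force
  qed
qed simp

section \<open>Measurability along the backward filtration\<close>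

lemma space_generated_sigma [simp]: "space (generated_sigma \<Omega> I X) = \<Omega>"
  by (simp add: generated_sigma_def space_measure_of_conv)

lemma measurable_generated_sigma:
  assumes "i \<in> I"
  shows "X i \<in> borel_measurable (generated_sigma \<Omega> I X)"
proof (rule measurableI)
  fix B :: "real set" assume "B \<in> sets borel"
  with assms show "X i -` B \<inter> space (generated_sigma \<Omega> I X) \<in> sets (generated_sigma \<Omega> I X)"
    unfolding space_generated_sigma
    by (subst generated_sigma_def, subst sets_measure_of) (auto intro: sigma_sets.Basic)
qed simp

lemma sets_generated_sigma_mono:
  assumes "I \<subseteq> J"
  shows "sets (generated_sigma \<Omega> I X) \<subseteq> sets (generated_sigma \<Omega> J X)"
  unfolding generated_sigma_def
  by (subst (1 2) sets_measure_of) (use assms in \<open>auto intro!: sigma_sets_mono'\<close>)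

lemma space_backward_filtration [simp]: "space (backward_filtration M m p t) = space M"
  by (simp add: backward_filtration_def)

lemma measurable_backward_filtration_mono:
  assumes "f \<in> borel_measurable (backward_filtration M m p t)" "s \<le> t"
  shows "f \<in> borel_measurable (backward_filtration M m p s)"
proof -
  have "sets (backward_filtration M m p t) \<subseteq> sets (backward_filtration M m p s)"
    using assms(2) unfolding backward_filtration_def by (intro sets_generated_sigma_mono) auto
  then show ?thesis
    using assms(1) by (auto simp: measurable_def)
qed

lemma sets_backward_filtration_le:
  assumes "i \<in> {1..m}" "s \<in> {t..1}"
  shows "{\<omega> \<in> space M. p i \<omega> \<le> s} \<in> sets (backward_filtration M m p t)"
proof -
  let ?X = "\<lambda>(i, s) \<omega>. of_bool (p i \<omega> \<le> s) :: real"
  have "?X (i, s) \<in> borel_measurable (backward_filtration M m p t)"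
    unfolding backward_filtration_def using assms by (intro measurable_generated_sigma) auto
  then have "?X (i, s) -` {1} \<inter> space M \<in> sets (backward_filtration M m p t)"
    by (auto dest: measurable_sets[of _ _ borel "{1}"])
  moreover have "?X (i, s) -` {1} \<inter> space M = {\<omega> \<in> space M. p i \<omega> \<le> s}"
    by auto
  ultimately show ?thesis
    by simp
qed

text \<open>
  At time \<open>r\<close> the backward filtration has watched the p-values above \<open>r\<close> only, so it
  identifies a p-value once it is truncated from below at any level \<open>s \<ge> r\<close>. Levels beyond 1 are
  not observed, but there the p-values cannot lie.
\<close>

lemma measurable_max_p_value:
  assumes "i \<in> {1..m}" "r \<le> s" and "\<And>\<omega>. \<omega> \<in> space M \<Longrightarrow> p i \<omega> \<le> 1"
  shows "(\<lambda>\<omega>. max (p i \<omega>) s) \<in> borel_measurable (backward_filtration M m p r)"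
proof (rule borel_measurableI_le)
  fix c :: real
  consider "c < s" | "s \<le> c" "c \<le> 1" | "s \<le> c" "1 < c"
    by linarith
  then have "{\<omega> \<in> space M. max (p i \<omega>) s \<le> c} \<in> sets (backward_filtration M m p r)"
  proof cases
    case 1
    then show ?thesis by auto
  next
    case 2
    then show ?thesis
      using sets_backward_filtration_le[of i m c r M p] assms by simp
  next
    case 3
    then have "{\<omega> \<in> space M. max (p i \<omega>) s \<le> c} = space (backward_filtration M m p r)"
      using assms(3) by force
    then show ?thesis by (metis sets.top)
  qed
  then show "{\<omega> \<in> space (backward_filtration M m p r). max (p i \<omega>) s \<le> c}
      \<in> sets (backward_filtration M m p r)"
    by simp
qed

text \<open>
  At a location \<open>\<tau> \<ge> s\<close>, truncating the p-values at \<open>s\<close> does not affect which of them are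
  rejected. Taking \<open>\<tau>\<close> random is what allows the truncated p-values themselves as locations.
\<close>

lemma measurable_storey_FDR:
  assumes q [measurable]: "q \<in> borel_measurable N" and \<tau> [measurable]: "\<tau> \<in> borel_measurable N"
    and p: "\<And>i. i \<in> {1..m} \<Longrightarrow> (\<lambda>\<omega>. max (p i \<omega>) s) \<in> borel_measurable N"
    and ge: "\<And>\<omega>. s \<le> \<tau> \<omega>"
  shows "(\<lambda>\<omega>. storey_FDR m p q (\<tau> \<omega>) \<omega>) \<in> borel_measurable N"
proof -
  have "real (num_rejections m p (\<tau> \<omega>) \<omega>)
      = (\<Sum>i=1..m. of_bool (max (p i \<omega>) s \<le> \<tau> \<omega>))" for \<omega>
    by (simp add: num_rejections_def ge)
  moreover have "(\<lambda>\<omega>. \<Sum>i=1..m. of_bool (max (p i \<omega>) s \<le> \<tau> \<omega>) :: real) \<in> borel_measurable N"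
  proof (rule borel_measurable_sum)
    fix i assume "i \<in> {1..m}"
    note [measurable] = p[OF this]
    show "(\<lambda>\<omega>. of_bool (max (p i \<omega>) s \<le> \<tau> \<omega>) :: real) \<in> borel_measurable N"
      by measurable
  qed
  ultimately have [measurable]: "(\<lambda>\<omega>. real (num_rejections m p (\<tau> \<omega>) \<omega>)) \<in> borel_measurable N"
    by simp
  show ?thesis
    unfolding storey_FDR_def of_nat_max by measurable
qed

lemma sets_storey_threshold_le:
  assumes "r \<le> s" "0 \<le> s" "0 \<le> \<alpha>"
    and q: "q \<in> borel_measurable (backward_filtration M m p r)"
    and p_le: "\<And>i \<omega>. i \<in> {1..m} \<Longrightarrow> \<omega> \<in> space M \<Longrightarrow> p i \<omega> \<le> 1"
    and q_nonneg: "\<And>\<omega>. \<omega> \<in> space M \<Longrightarrow> 0 \<le> q \<omega>"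
  shows "{\<omega> \<in> space M. storey_threshold m p q \<alpha> \<omega> \<le> s} \<in> sets (backward_filtration M m p r)"
proof -
  let ?N = "backward_filtration M m p r"
  let ?F = "storey_FDR m p q"
  have p_meas: "(\<lambda>\<omega>. max (p i \<omega>) s) \<in> borel_measurable ?N" if "i \<in> {1..m}" for i
    using that assms by (intro measurable_max_p_value) auto
  have at_const: "{\<omega> \<in> space ?N. ?F t \<omega> \<le> \<alpha>} \<in> sets ?N" if "t \<in> {s<..1}" for t
  proof -
    have [measurable]: "(\<lambda>\<omega>. ?F t \<omega>) \<in> borel_measurable ?N"
      using that q p_meas by (intro measurable_storey_FDR[where \<tau> = "\<lambda>_. t" and s = s]) auto
    show ?thesis
      by measurable
  qed
  have at_p_value: "{\<omega> \<in> space ?N. s < max (p i \<omega>) s \<and> ?F (max (p i \<omega>) s) \<omega> \<le> \<alpha>} \<in> sets ?N"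
    if "i \<in> {1..m}" for i
  proof -
    note [measurable] = p_meas[OF that]
    have [measurable]: "(\<lambda>\<omega>. ?F (max (p i \<omega>) s) \<omega>) \<in> borel_measurable ?N"
      using q p_meas by (intro measurable_storey_FDR[where s = s]) auto
    show ?thesis
      by measurable
  qed
  have "{\<omega> \<in> space M. storey_threshold m p q \<alpha> \<omega> \<le> s} = space ?N -
      ((\<Union>t\<in>\<rat> \<inter> {s<..1}. {\<omega> \<in> space ?N. ?F t \<omega> \<le> \<alpha>}) \<union>
       (\<Union>i\<in>{1..m}. {\<omega> \<in> space ?N. s < max (p i \<omega>) s \<and> ?F (max (p i \<omega>) s) \<omega> \<le> \<alpha>}))"
    (is "?A = ?B")
  proof (rule set_eqI)
    fix \<omega>
    show "\<omega> \<in> ?A \<longleftrightarrow> \<omega> \<in> ?B"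
    proof (cases "\<omega> \<in> space M")
      case True
      have "\<omega> \<in> ?A \<longleftrightarrow> \<not> ((\<exists>t\<in>\<rat> \<inter> {s<..1}. ?F t \<omega> \<le> \<alpha>) \<or>
          (\<exists>i\<in>{1..m}. p i \<omega> \<in> {s<..1} \<and> ?F (p i \<omega>) \<omega> \<le> \<alpha>))"
        using True
        by (simp only: mem_Collect_eq simp_thms storey_threshold_le_iff[OF assms(3,2)]
            ex_storey_FDR_le_iff[of q \<omega> s m p \<alpha>, OF q_nonneg[OF True] assms(2)])
      also have "\<dots> \<longleftrightarrow> \<omega> \<in> ?B"
        using True p_le by (auto simp: less_max_iff_disj)
      finally show ?thesis .
    qed simp
  qed
  also have "\<dots> \<in> sets ?N"
    using at_const at_p_value
    by (intro sets.compl_sets sets.Un sets.countable_UN'' sets.finite_UN)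
       (auto intro: countable_subset[OF _ countable_rat])
  finally show ?thesis .
qed

section \<open>Storey-type thresholds are backward stopping times\<close>

theorem theorem1:
  fixes M :: "'a measure"
    and m :: nat
    and p :: "nat \<Rightarrow> 'a \<Rightarrow> real"
    and \<alpha> lam :: real
    and pi0 :: "real \<Rightarrow> 'a \<Rightarrow> real"
  assumes "prob_space M"
    and "m \<ge> 1"
    and "\<And>i. i \<in> {1..m} \<Longrightarrow> p i \<in> borel_measurable M"
    and "\<And>i \<omega>. i \<in> {1..m} \<Longrightarrow> \<omega> \<in> space M \<Longrightarrow> p i \<omega> \<in> {0..1}"
    and "\<alpha> \<in> {0..1}"
    and "lam \<in> {0..<1}"
    and "pi0 lam \<in> borel_measurable M"
    and "\<And>\<omega>. \<omega> \<in> space M \<Longrightarrow> pi0 lam \<omega> \<in> {0..1}"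
  shows "(regular_estimator M m p lam (pi0 lam) \<longrightarrow>
            backward_stopping_time (stopped_backward_filtration M m p lam)
              (storey_threshold m p (pi0 lam) \<alpha>)) \<and>
         (\<forall>\<omega>\<in>space M. storey_threshold m p (pi0 lam) \<alpha> \<omega> < 1 \<longrightarrow>
            storey_FDR m p (pi0 lam) (storey_threshold m p (pi0 lam) \<alpha> \<omega>) \<omega> = \<alpha>)"
proof (intro conjI impI ballI)
  assume reg: "regular_estimator M m p lam (pi0 lam)"
  show "backward_stopping_time (stopped_backward_filtration M m p lam)
      (storey_threshold m p (pi0 lam) \<alpha>)"
    unfolding backward_stopping_time_def stopped_backward_filtration_def
  proof
    fix s :: real assume s: "s \<in> {0..1}"
    \<comment> \<open>Stopping the filtration at \<open>lam\<close> is what keeps the estimator known at every time.\<close>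
    have "pi0 lam \<in> borel_measurable (backward_filtration M m p (min s lam))"
      using reg unfolding regular_estimator_def
      by (rule measurable_backward_filtration_mono) simp
    then show "{\<omega> \<in> space (backward_filtration M m p (min s lam)).
        storey_threshold m p (pi0 lam) \<alpha> \<omega> \<le> s} \<in> sets (backward_filtration M m p (min s lam))"
      unfolding space_backward_filtration using s assms(4,5,8)
      by (intro sets_storey_threshold_le) auto
  qed
next
  fix \<omega> assume \<omega>: "\<omega> \<in> space M" and "storey_threshold m p (pi0 lam) \<alpha> \<omega> < 1"
  then show "storey_FDR m p (pi0 lam) (storey_threshold m p (pi0 lam) \<alpha> \<omega>) \<omega> = \<alpha>"
    using assms(5) assms(8)[OF \<omega>]
    by (intro antisym storey_FDR_threshold_le storey_FDR_threshold_ge) auto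
qed

end
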